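(* Let $\Omega=\{\omega_1,\dots,\omega_k\}\subseteq\mathbb{Q}^n$. Then the facet gap $\varphi$ of $\Omega$ satisfies $$\log_2\frac1\varphi\le(6n^2+1)\max_{i\in[k]}\langle\omega_i\rangle-n.$$
   Context: The facet gap $\varphi>0$ of $\Omega$ is the smallest Euclidean distance $d(\omega,\operatorname{aff}\mathcal F)$ over all facets $\mathcal F$ of $\operatorname{conv}\Omega$ and all $\omega\in\Omega\setminus \mathcal F$ ($\operatorname{aff}$ = affine hull; facets are faces of codimension one relative to $\operatorname{aff}\Omega$); $\Omega$ is assumed to contain at least two points so that $\varphi$ is well-defined. $\langle\cdot\rangle$ is the binary encoding length in the convention of Grötschel–Lovász–Schrijver: $\langle m\rangle=1+\lceil\log_2(|m|+1)\rceil$ for an integer $m$; $\langle p/s\rangle=\langle p\rangle+\langle s\rangle$ for coprime integers $p,s$ with $s>0$; $\langle v\rangle=n+\sum_{j=1}^n\langle v_j\rangle$ for $v\in\mathbb{Q}^n$. *)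

theory Defs
  imports "HOL-Analysis.Analysis"
begin

definition enc_int :: "int \<Rightarrow> int" where
  "enc_int m = 1 + \<lceil>log 2 (real_of_int (\<bar>m\<bar> + 1))\<rceil>"

text \<open>\<^const>\<open>quotient_of\<close> returns the unique coprime representation with positive denominator.\<close>

definition enc_rat :: "rat \<Rightarrow> int" where
  "enc_rat q = (let (p, s) = quotient_of q in enc_int p + enc_int s)"

definition enc_vec :: "rat ^ 'n \<Rightarrow> int" where
  "enc_vec v = int CARD('n) + (\<Sum>j\<in>UNIV. enc_rat (v $ j))"

definition real_vec :: "rat ^ 'n \<Rightarrow> real ^ 'n" where
  "real_vec v = (\<chi> j. real_of_rat (v $ j))"

text \<open>
  The dimension of a facet in the sense of \<open>facet_of\<close> is one less than \<open>aff_dim (convex hull \<Omega>)\<close>,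
  so codimension is relative to the affine hull of \<open>\<Omega>\<close>; in particular the facets of a segment
  are its two endpoints. The set below is finite and nonempty when \<open>\<Omega>\<close> is finite with at
  least two points, and the definition is only meaningful in that case.
\<close>

definition facet_gap :: "'a::euclidean_space set \<Rightarrow> real" where
  "facet_gap \<Omega> =
     Min {infdist \<omega> (affine hull F) | \<omega> F. F facet_of (convex hull \<Omega>) \<and> \<omega> \<in> \<Omega> - F}"

end

theory Submission
  imports Defs
begin

text \<open>
  Fix a facet \<open>F\<close>, a vertex \<open>a\<close> of it and \<open>w \<in> \<Omega> - F\<close>. Extend \<open>w - a\<close> and a basis of the
  direction space of \<open>F\<close> by unit vectors to a basis of the whole space, and let \<open>A\<close> be the matrix
  with these rows. Clearing denominators row by row turns \<open>det A \<noteq> 0\<close> into a nonzero integer, so its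
  absolute value is at least 1. For \<open>z\<close> in the affine hull of \<open>F\<close>, replacing the row \<open>w - a\<close> by
  \<open>w - z\<close> does not change the determinant, which is at most the product of the l1 norms of the rows.
  As the other rows are short, \<open>w - z\<close> cannot be. Using differences of points doubles
  the exponent compared with homogenizing to dimension \<open>n + 1\<close>, but the bound leaves ample room.
\<close>

section \<open>Determinants and rows with bounded denominators\<close>

text \<open>A single multiplier \<open>q\<close> serves both bounds. For most rows of a matrix the
  bound on the scaled l1 norm is needed; for the one row that gets replaced by a real vector, only
  the bound on \<open>q\<close> itself survives.\<close>

definition denom_l1_le :: "real \<Rightarrow> real ^ 'n \<Rightarrow> bool" where
  "denom_l1_le N x \<longleftrightarrow> (\<exists>q::int. 0 < q \<and> (\<forall>j. of_int q * x $ j \<in> \<int>)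
     \<and> of_int q \<le> N \<and> of_int q * (\<Sum>j\<in>UNIV. \<bar>x $ j\<bar>) \<le> N)"

text \<open>Multiplying out the product of row sums gives one nonnegative term for every map from
  rows to columns, and the permutations of the Leibniz formula are among these maps.\<close>

lemma abs_det_le_prod_l1:
  fixes A :: "real ^ 'n ^ 'n"
  shows "\<bar>det A\<bar> \<le> (\<Prod>i\<in>UNIV. \<Sum>j\<in>UNIV. \<bar>A $ i $ j\<bar>)"
proof -
  have "\<bar>det A\<bar> \<le> (\<Sum>p | p permutes UNIV. \<bar>of_int (sign p) * (\<Prod>i\<in>UNIV. A $ i $ p i)\<bar>)"
    unfolding det_def by (rule sum_abs)
  also have "\<dots> = (\<Sum>p | p permutes (UNIV :: 'n set). \<Prod>i\<in>UNIV. \<bar>A $ i $ p i\<bar>)"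
    by (intro sum.cong refl) (simp add: abs_mult abs_prod sign_def)
  also have "\<dots> \<le> (\<Sum>p\<in>(UNIV :: 'n set) \<rightarrow>\<^sub>E UNIV. \<Prod>i\<in>UNIV. \<bar>A $ i $ p i\<bar>)"
    by (intro sum_mono2 finite_PiE) (auto intro: prod_nonneg)
  also have "\<dots> = (\<Prod>i\<in>UNIV. \<Sum>j\<in>UNIV. \<bar>A $ i $ j\<bar>)"
    by (rule prod_sum_PiE [symmetric]) auto
  finally show ?thesis .
qed

lemma det_Ints:
  fixes A :: "'a::comm_ring_1 ^ 'n ^ 'n"
  assumes "\<And>i j. A $ i $ j \<in> \<int>"
  shows "det A \<in> \<int>"
  unfolding det_def using assms by (auto intro!: Ints_sum Ints_mult Ints_prod)

section \<open>Encoding length controls denominators and l1 norms\<close>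

lemma enc_int_bound: "real_of_int (\<bar>m\<bar> + 1) \<le> 2 powr (of_int (enc_int m) - 1)"
proof -
  have "real_of_int (\<bar>m\<bar> + 1) = 2 powr log 2 (of_int (\<bar>m\<bar> + 1))"
    by (rule powr_log_cancel [symmetric]) auto
  also have "\<dots> \<le> 2 powr (of_int (enc_int m) - 1)"
    unfolding enc_int_def by (intro powr_mono) auto
  finally show ?thesis .
qed

text \<open>For r = p/s the left side equals s + |p|, which is at most (|p| + 1)(s + 1). Numerator
  and denominator each leave one spare bit, hence the 2 in the exponent.\<close>

lemma enc_rat_bound:
  assumes "quotient_of r = (p, s)"
  shows "real_of_int s * (1 + \<bar>of_rat r\<bar>) \<le> 2 powr (of_int (enc_rat r) - 2)"
proof -
  have s: "0 < s" using assms by (rule quotient_of_denom_pos)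
  have r: "of_rat r = (of_int p / of_int s :: real)"
    using quotient_of_div [OF assms] by (simp add: of_rat_divide)
  have "of_int s * (1 + \<bar>of_rat r\<bar>) = (of_int (s + \<bar>p\<bar>) :: real)"
    using s by (simp add: r abs_divide field_simps)
  also have "\<dots> \<le> of_int ((\<bar>p\<bar> + 1) * (\<bar>s\<bar> + 1))"
  proof -
    have "0 \<le> \<bar>p\<bar> * \<bar>s\<bar>" by simp
    then show ?thesis unfolding of_int_le_iff using s by (simp add: algebra_simps del: zero_le_mult_iff)
  qed
  also have "\<dots> \<le> 2 powr (of_int (enc_int p) - 1) * 2 powr (of_int (enc_int s) - 1)"
    unfolding of_int_mult by (intro mult_mono enc_int_bound) auto
  also have "\<dots> = 2 powr (of_int (enc_rat r) - 2)"
    by (simp add: assms enc_rat_def powr_add [symmetric])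
  finally show ?thesis .
qed

lemma one_plus_sum_le_prod:
  fixes f :: "'a \<Rightarrow> real"
  assumes "finite A" "\<And>x. x \<in> A \<Longrightarrow> 0 \<le> f x"
  shows "1 + sum f A \<le> (\<Prod>x\<in>A. 1 + f x)"
  using assms
proof (induction A)
  case (insert x A)
  have "1 + sum f A \<le> (\<Prod>x\<in>A. 1 + f x)" by (rule insert.IH) (simp add: insert.prems)
  then have "(1 + f x) * (1 + sum f A) \<le> (1 + f x) * (\<Prod>x\<in>A. 1 + f x)"
    by (intro mult_left_mono) (auto simp: insert.prems add_nonneg_nonneg)
  moreover have "0 \<le> f x * sum f A" using insert.prems by (auto intro!: mult_nonneg_nonneg sum_nonneg)
  ultimately show ?case using insert.hyps by (simp add: algebra_simps)
qed simp

text \<open>The multiplier is the product of the coordinate denominators. In the exponent, each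
  coordinate saves two bits by \<open>enc_rat_bound\<close> and one more from the summand
  \<open>CARD('n)\<close> of \<open>enc_vec\<close>. The added 1 lets one inequality bound both
  \<open>q\<close> and the scaled l1 norm.\<close>

lemma real_vec_denom:
  fixes v :: "rat ^ 'n"
  shows "\<exists>q::int. 0 < q \<and> (\<forall>j. of_int q * real_vec v $ j \<in> \<int>) \<and>
    of_int q * (1 + (\<Sum>j\<in>UNIV. \<bar>real_vec v $ j\<bar>)) \<le> 2 powr (of_int (enc_vec v) - 3 * real CARD('n))"
proof -
  define s where "s j = snd (quotient_of (v $ j))" for j
  define p where "p j = fst (quotient_of (v $ j))" for j
  have ps: "quotient_of (v $ j) = (p j, s j)" for j by (simp add: p_def s_def)
  have spos: "0 < s j" for j using ps by (rule quotient_of_denom_pos)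
  have vj: "real_vec v $ j = of_int (p j) / of_int (s j)" for j
    using quotient_of_div [OF ps] by (simp add: real_vec_def of_rat_divide)
  let ?q = "prod s UNIV"
  have "of_int ?q * real_vec v $ j \<in> \<int>" for j
  proof -
    have "of_int ?q * real_vec v $ j = of_int (prod s (UNIV - {j}) * p j)"
      using spos [of j] by (simp add: vj prod.remove [of UNIV j s])
    then show ?thesis by (metis Ints_of_int)
  qed
  moreover have "of_int ?q * (1 + (\<Sum>j\<in>UNIV. \<bar>real_vec v $ j\<bar>)) \<le> of_int ?q * (\<Prod>j\<in>UNIV. 1 + \<bar>real_vec v $ j\<bar>)"
    using spos by (intro mult_left_mono one_plus_sum_le_prod) (auto intro!: prod_nonneg simp: less_imp_le)
  moreover have "of_int ?q * (\<Prod>j\<in>UNIV. 1 + \<bar>real_vec v $ j\<bar>) = (\<Prod>j\<in>UNIV. of_int (s j) * (1 + \<bar>real_vec v $ j\<bar>))"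
    by (simp add: prod.distrib)
  moreover have "\<dots> \<le> (\<Prod>j\<in>UNIV. 2 powr (of_int (enc_rat (v $ j)) - 2))"
    using enc_rat_bound [OF ps] spos by (intro prod_mono) (auto simp: real_vec_def less_imp_le)
  moreover have "\<dots> = 2 powr (of_int (enc_vec v) - 3 * real CARD('n))"
    by (simp add: powr_sum [symmetric] enc_vec_def sum_subtractf mult.commute)
  ultimately show ?thesis using spos by (intro exI [of _ ?q]) (auto intro: prod_pos)
qed

text \<open>The product of the two multipliers clears the denominators of the difference, so the
  bounds multiply and the exponent doubles.\<close>

lemma real_vec_diff_denom_l1_le:
  fixes u v :: "rat ^ 'n"
  assumes "enc_vec u \<le> E" "enc_vec v \<le> E"
  shows "denom_l1_le (2 powr (2 * (of_int E - 3 * real CARD('n)))) (real_vec u - real_vec v)"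
proof -
  let ?M = "2 powr (of_int E - 3 * real CARD('n))"
  define S :: "rat ^ 'n \<Rightarrow> real" where "S x = (\<Sum>j\<in>UNIV. \<bar>real_vec x $ j\<bar>)" for x
  have S: "0 \<le> S x" for x by (simp add: S_def sum_nonneg)
  have *: "\<exists>q::int. 0 < q \<and> (\<forall>j. of_int q * real_vec x $ j \<in> \<int>) \<and> of_int q * (1 + S x) \<le> ?M"
    if "enc_vec x \<le> E" for x
  proof -
    have "2 powr (of_int (enc_vec x) - 3 * real CARD('n)) \<le> ?M" using that by (intro powr_mono) auto
    then show ?thesis using real_vec_denom [of x] unfolding S_def by (meson order_trans)
  qed
  obtain a :: int where a: "0 < a" "\<And>j. of_int a * real_vec u $ j \<in> \<int>" "of_int a * (1 + S u) \<le> ?M"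
    using * [OF assms(1)] by blast
  obtain b :: int where b: "0 < b" "\<And>j. of_int b * real_vec v $ j \<in> \<int>" "of_int b * (1 + S v) \<le> ?M"
    using * [OF assms(2)] by blast
  have M2: "2 powr (2 * (of_int E - 3 * real CARD('n))) = ?M * ?M"
    by (simp add: powr_add [symmetric])
  have prod: "of_int (a * b) * ((1 + S u) * (1 + S v)) \<le> ?M * ?M"
    using mult_mono [OF a(3) b(3)] a(1) b(1) S [of u] S [of v] by (simp add: mult_ac)
  have ab: "(0::real) \<le> of_int (a * b)" using a(1) b(1) by simp
  have "of_int (a * b) * (real_vec u - real_vec v) $ j \<in> \<int>" for j
  proof -
    have "of_int (a * b) * (real_vec u - real_vec v) $ j
        = of_int b * (of_int a * real_vec u $ j) - of_int a * (of_int b * real_vec v $ j)"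
      by (simp add: algebra_simps)
    also have "\<dots> \<in> \<int>" by (rule Ints_diff [OF Ints_mult [OF Ints_of_int a(2)] Ints_mult [OF Ints_of_int b(2)]])
    finally show ?thesis .
  qed
  moreover have "of_int (a * b) \<le> ?M * ?M"
  proof -
    have "1 * 1 \<le> (1 + S u) * (1 + S v)" using S [of u] S [of v] by (intro mult_mono) auto
    from mult_left_mono [OF this ab] show ?thesis using prod by linarith
  qed
  moreover have "of_int (a * b) * (\<Sum>j\<in>UNIV. \<bar>(real_vec u - real_vec v) $ j\<bar>) \<le> ?M * ?M"
  proof -
    have "(\<Sum>j\<in>UNIV. \<bar>(real_vec u - real_vec v) $ j\<bar>) \<le> S u + S v"
      unfolding S_def sum.distrib [symmetric] by (intro sum_mono) auto
    also have "\<dots> \<le> (1 + S u) * (1 + S v)" using S [of u] S [of v] by (simp add: algebra_simps)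
    finally show ?thesis using mult_left_mono [OF _ ab] prod by (meson order_trans)
  qed
  ultimately show ?thesis
    unfolding denom_l1_le_def M2 using a(1) b(1) by (intro exI [of _ "a * b"]) auto
qed

lemma denom_l1_le_axis:
  assumes "1 \<le> N"
  shows "denom_l1_le N (axis i 1 :: real ^ 'n)"
  using assms unfolding denom_l1_le_def
  by (intro exI [of _ 1]) (auto simp: axis_def if_distrib [of abs] cong: if_cong)

section \<open>Distance from a vector to a span\<close>

lemma det_lower_bound:
  fixes e :: "'n \<Rightarrow> real ^ 'n"
  assumes rows: "\<And>i. denom_l1_le N (e i)" and nz: "det (\<chi> i. e i) \<noteq> 0"
    and y: "y \<in> span (e ` (UNIV - {k}))"
  shows "1 \<le> real CARD('n) * N ^ CARD('n) * norm (e k - y)"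
proof -
  obtain q :: "'n \<Rightarrow> int" where q: "\<And>i. 0 < q i" "\<And>i j. of_int (q i) * e i $ j \<in> \<int>"
      "\<And>i. of_int (q i) \<le> N" "\<And>i. of_int (q i) * (\<Sum>j\<in>UNIV. \<bar>e i $ j\<bar>) \<le> N"
    using rows unfolding denom_l1_le_def by metis
  define e' where "e' i = (if i = k then e k - y else e i)" for i
  have N: "0 \<le> N" using q(1,3) [of k] by linarith
  have "1 \<le> \<bar>det (\<chi> i. of_int (q i) *s e i)\<bar>"
  proof -
    have "det (\<chi> i. of_int (q i) *s e i) \<in> \<int>" using q(2) by (intro det_Ints) simp
    moreover have "det (\<chi> i. of_int (q i) *s e i) \<noteq> 0"
      using nz q(1) by (simp add: det_rows_mul less_imp_neq [symmetric] prod_zero_iff)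
    ultimately show ?thesis by (rule Ints_nonzero_abs_ge1)
  qed
  also have "det (\<chi> i. of_int (q i) *s e i) = det (\<chi> i. of_int (q i) *s e' i)"
  proof -
    have "{row j (\<chi> i. e i) |j. j \<noteq> k} = e ` (UNIV - {k})" by (auto simp: row_def)
    then have "- y \<in> vec.span {row j (\<chi> i. e i) |j. j \<noteq> k}" 
      using y by (simp add: span_vec_eq span_neg)
    \<comment> \<open>Adding \<open>- y\<close>, a combination of the other rows, to row
      \<open>k\<close> leaves the determinant unchanged.\<close>
    from det_row_span [OF this] have "det (\<chi> i. e' i) = det (\<chi> i. e i)"
      by (simp add: row_def e'_def cong: if_cong)
    then show ?thesis by (simp only: det_rows_mul)
  qed
  also have "\<bar>\<dots>\<bar> \<le> (\<Prod>i\<in>UNIV. \<Sum>j\<in>UNIV. \<bar>of_int (q i) * e' i $ j\<bar>)"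
    using abs_det_le_prod_l1 [of "\<chi> i. of_int (q i) *s e' i"] by simp
  also have "\<dots> = (\<Prod>i\<in>UNIV. of_int (q i) * (\<Sum>j\<in>UNIV. \<bar>e' i $ j\<bar>))"
    using q(1) by (simp add: abs_mult sum_distrib_left less_imp_le)
  also have "\<dots> = (of_int (q k) * (\<Sum>j\<in>UNIV. \<bar>(e k - y) $ j\<bar>))
      * (\<Prod>i\<in>UNIV - {k}. of_int (q i) * (\<Sum>j\<in>UNIV. \<bar>e i $ j\<bar>))"
    by (subst prod.remove [of UNIV k]) (auto simp: e'_def)
  \<comment> \<open>In row \<open>k\<close> only \<open>q k\<close> is bounded by \<open>N\<close>;
    each of the other n - 1 rows is bounded by \<open>N\<close> together with its l1 norm.\<close>
  also have "\<dots> \<le> (N * (\<Sum>j\<in>UNIV. \<bar>(e k - y) $ j\<bar>)) * N ^ (CARD('n) - 1)"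
  proof (rule mult_mono)
    have "(\<Prod>i\<in>UNIV - {k}. of_int (q i) * (\<Sum>j\<in>UNIV. \<bar>e i $ j\<bar>)) \<le> (\<Prod>i\<in>UNIV - {k}. N)"
      using q(1,4) by (intro prod_mono) (auto intro!: mult_nonneg_nonneg sum_nonneg simp: less_imp_le)
    then show "(\<Prod>i\<in>UNIV - {k}. of_int (q i) * (\<Sum>j\<in>UNIV. \<bar>e i $ j\<bar>)) \<le> N ^ (CARD('n) - 1)"
      by (simp add: card_Diff_singleton)
  qed (use q(1,3) N in \<open>auto intro!: mult_right_mono prod_nonneg mult_nonneg_nonneg sum_nonneg simp: less_imp_le\<close>)
  also have "\<dots> = N ^ CARD('n) * (\<Sum>j\<in>UNIV. \<bar>(e k - y) $ j\<bar>)"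
    by (cases "CARD('n)") auto
  \<comment> \<open>The factor \<open>CARD('n)\<close> is the price of passing from the l1 norm to
    the Euclidean norm.\<close>
  also have "\<dots> \<le> N ^ CARD('n) * (\<Sum>j\<in>(UNIV :: 'n set). norm (e k - y))"
    using N by (intro mult_left_mono sum_mono component_le_norm_cart) auto
  finally show ?thesis by (simp add: mult_ac)
qed

text \<open>Completing \<open>w\<close> and a basis of \<open>span B\<close> by unit vectors gives a
  nonsingular square matrix for \<open>det_lower_bound\<close>. Since 1 \<le> \<open>N\<close>, the
  unit vectors meet the row bound with multiplier 1.\<close>

lemma norm_span_lower_bound:
  fixes w :: "real ^ 'n" and B :: "(real ^ 'n) set"
  assumes N: "1 \<le> N" and rows: "\<And>x. x \<in> insert w B \<Longrightarrow> denom_l1_le N x"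
    and w: "w \<notin> span B" and y: "y \<in> span B"
  shows "1 \<le> real CARD('n) * N ^ CARD('n) * norm (w - y)"
proof -
  obtain B' where B': "B' \<subseteq> B" "independent B'" "B \<subseteq> span B'"
    using maximal_independent_subset [of B] by blast
  then have sp: "span B' = span B" by (metis span_eq span_superset subset_trans)
  have ind: "independent (insert w B')" using B'(2) w sp by (simp add: independent_insert)
  obtain C where C: "insert w B' \<subseteq> C" "C \<subseteq> insert w B' \<union> Basis" "independent C"
      "insert w B' \<union> Basis \<subseteq> span C"
    using maximal_independent_subset_extend [of "insert w B'" "insert w B' \<union> Basis"] ind by blast
  have spC: "span C = UNIV"
    using C(4) span_Basis by (metis le_sup_iff span_minimal subspace_span top.extremum_uniqueI)
  have "finite C" "card C = CARD('n)"
    using C(3) spC by (metis independent_imp_finite, metis dim_span_eq_card_independent dim_UNIV DIM_cart DIM_real mult.right_neutral)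
  then obtain e :: "'n \<Rightarrow> real ^ 'n" where e: "bij_betw e UNIV C"
    using finite_same_card_bij [of "UNIV :: 'n set" C] by auto
  have ran: "range e = C" using e by (simp add: bij_betw_def)
  obtain k where k: "e k = w" using C(1) ran by blast
  have "rows (\<chi> i. e i) = C" using ran by (auto simp: rows_def row_def)
  then have "det (\<chi> i. e i) \<noteq> 0"
    using spC matrix_left_invertible_span_rows invertible_left_inverse invertible_det_nz by metis
  moreover have "denom_l1_le N (e i)" for i
  proof -
    have "e i \<in> insert w B \<union> Basis" using ran C(2) B'(1) by blast
    then show ?thesis using rows denom_l1_le_axis [OF N] by (auto simp: Basis_vec_def)
  qed
  moreover have "y \<in> span (e ` (UNIV - {k}))"
  proof -
    \<comment> \<open>Leaving out the row \<open>w\<close> therefore removes no element of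
      \<open>B'\<close>, and the remaining rows still span \<open>y\<close>.\<close>
    have "w \<notin> B'" using w sp span_base by blast
    then have "B' \<subseteq> e ` (UNIV - {k})" using C(1) ran k by fastforce
    then show ?thesis using y sp span_mono by blast
  qed
  ultimately show ?thesis using det_lower_bound [of N e y k] k by blast
qed

section \<open>Facets and the facet gap\<close>

text \<open>A face of the hull is itself the hull of points of \<Omega>, so the direction space of
  its affine hull is spanned by differences of such points, to which \<open>diff\<close>
  applies.\<close>

lemma infdist_facet_lower_bound:
  fixes \<Omega> :: "(real ^ 'n) set"
  assumes fin: "finite \<Omega>" and N: "1 \<le> N"
    and diff: "\<And>u v. u \<in> \<Omega> \<Longrightarrow> v \<in> \<Omega> \<Longrightarrow> denom_l1_le N (u - v)"
    and F: "F facet_of convex hull \<Omega>" and w: "w \<in> \<Omega> - F"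
  shows "1 \<le> real CARD('n) * N ^ CARD('n) * infdist w (affine hull F)"
proof -
  have face: "F face_of convex hull \<Omega>" and ne: "F \<noteq> {}"
    using F by (auto simp: facet_of_def)
  obtain S where S: "S \<subseteq> \<Omega>" "F = convex hull S"
    using face_of_convex_hull_subset [OF finite_imp_compact [OF fin] face] by blast
  obtain a where a: "a \<in> S" using S ne by fastforce
  define B where "B = (\<lambda>x. - a + x) ` S"
  have aff: "affine hull F = (\<lambda>x. a + x) ` span B"
    unfolding B_def S(2) affine_hull_convex_hull
    by (rule affine_hull_span_gen) (simp add: a hull_inc)
  \<comment> \<open>A face is the intersection of the convex set with the affine hull of the face,
    and \<open>w\<close> lies in the set but not in the face.\<close>
  have "w \<notin> affine hull F"
    using face_of_imp_eq_affine_Int [OF convex_convex_hull face] w by (auto intro: hull_inc)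
  then have wB: "w - a \<notin> span B" unfolding aff by force
  have "denom_l1_le N x" if "x \<in> insert (w - a) B" for x
    using that a S(1) w diff unfolding B_def by auto
  note low = norm_span_lower_bound [OF N this wB]
  let ?c = "real CARD('n) * N ^ CARD('n)"
  have c: "0 < ?c" using N by simp
  have "1 / ?c \<le> dist w z" if "z \<in> affine hull F" for z
  proof -
    obtain y where "y \<in> span B" "z = a + y" using \<open>z \<in> affine hull F\<close> aff by blast
    then show ?thesis using low [of y] c by (simp add: dist_norm field_simps)
  qed
  then have "1 / ?c \<le> infdist w (affine hull F)"
    using ne by (auto simp: infdist_def intro!: cINF_greatest)
  then show ?thesis using c by (simp add: field_simps)
qed

text \<open>\<open>Min\<close> yields an element only of a finite nonempty set. Finiteness holds
  because a polytope has finitely many facets. Two points force positive dimension, so a facet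
  exists, and it cannot contain all of \<Omega> without being the whole hull.\<close>

lemma facet_gap_attained:
  fixes \<Omega> :: "'a::euclidean_space set"
  assumes fin: "finite \<Omega>" and card: "2 \<le> card \<Omega>"
  obtains w F where "F facet_of convex hull \<Omega>" "w \<in> \<Omega> - F" "facet_gap \<Omega> = infdist w (affine hull F)"
proof -
  let ?P = "convex hull \<Omega>"
  let ?D = "{infdist w (affine hull F) | w F. F facet_of ?P \<and> w \<in> \<Omega> - F}"
  have poly: "polytope ?P" using fin by (rule polytope_convex_hull)
  have "?D \<subseteq> (\<lambda>(w, F). infdist w (affine hull F)) ` (\<Omega> \<times> {F. F facet_of ?P})" by auto
  then have finD: "finite ?D"
    using fin finite_polytope_facets [OF poly] by (meson finite_SigmaI finite_imageI finite_subset)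
  have "\<Omega> \<noteq> {}" "\<nexists>a. \<Omega> = {a}" using card by auto
  then have "0 < aff_dim \<Omega>"
    using aff_dim_negative_iff [of \<Omega>] aff_dim_eq_0 [of \<Omega>] by (metis linorder_neqE)
  then obtain F where F: "F facet_of ?P"
    using polytope_facet_exists [OF poly] by (auto simp: aff_dim_convex_hull)
  have "\<not> \<Omega> \<subseteq> F"
  proof
    assume "\<Omega> \<subseteq> F"
    moreover have "convex F" "F \<subseteq> ?P" using F by (auto simp: facet_of_def face_of_imp_convex face_of_imp_subset)
    ultimately have "F = ?P" by (simp add: hull_minimal subset_antisym)
    then show False using F by simp
  qed
  then have "?D \<noteq> {}" using F by blast
  then have "facet_gap \<Omega> \<in> ?D" unfolding facet_gap_def by (rule Min_in [OF finD])
  then show ?thesis using that by blast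
qed

theorem lemma4p2:
  fixes \<omega> :: "nat \<Rightarrow> rat ^ 'n" and k :: nat and \<Omega> :: "(real ^ 'n) set"
  assumes "\<Omega> = (\<lambda>i. real_vec (\<omega> i)) ` {1..k}"
    and "card \<Omega> \<ge> 2"
  shows "log 2 (1 / facet_gap \<Omega>)
      \<le> (6 * real CARD('n) ^ 2 + 1) * real_of_int (MAX i\<in>{1..k}. enc_vec (\<omega> i)) - real CARD('n)"
proof -
  let ?n = "real CARD('n)"
  define E where "E = (MAX i\<in>{1..k}. enc_vec (\<omega> i))"
  have fin: "finite \<Omega>" using assms(1) by simp
  have k: "{1..k} \<noteq> {}" using assms by (metis card.empty image_empty not_numeral_le_zero)
  have leE: "enc_vec (\<omega> i) \<le> E" if "i \<in> {1..k}" for i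
    unfolding E_def using that by (intro Max_ge) auto
  have n1: "1 \<le> ?n" by (simp add: Suc_leI)
  \<comment> \<open>This makes the exponent in \<open>N\<close> nonnegative and also absorbs the
    linear terms at the end. It follows because \<open>q\<close> times a number at least 1 is itself
    at least 1.\<close>
  have E3: "3 * ?n \<le> of_int E"
  proof -
    obtain i where i: "i \<in> {1..k}" using k by blast
    obtain q :: int where q: "0 < q"
      "of_int q * (1 + (\<Sum>j\<in>UNIV. \<bar>real_vec (\<omega> i) $ j\<bar>)) \<le> 2 powr (of_int (enc_vec (\<omega> i)) - 3 * ?n)"
      using real_vec_denom [of "\<omega> i"] by blast
    have "1 * 1 \<le> of_int q * (1 + (\<Sum>j\<in>UNIV. \<bar>real_vec (\<omega> i) $ j\<bar>))"
      using q(1) by (intro mult_mono) (auto simp: sum_nonneg)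
    with q(2) have "1 \<le> 2 powr (of_int (enc_vec (\<omega> i)) - 3 * ?n)" by linarith
    then have "3 * ?n \<le> of_int (enc_vec (\<omega> i))"
      using powr_le_cancel_iff [of 2 0 "of_int (enc_vec (\<omega> i)) - 3 * ?n"] by simp
    then show ?thesis using leE [OF i] by linarith
  qed
  define N :: real where "N = 2 powr (2 * (of_int E - 3 * ?n))"
  have N: "1 \<le> N" unfolding N_def using E3 by (intro ge_one_powr_ge_zero) auto
  have "denom_l1_le N (u - v)" if "u \<in> \<Omega>" "v \<in> \<Omega>" for u v
  proof -
    obtain i j where "i \<in> {1..k}" "j \<in> {1..k}" "u = real_vec (\<omega> i)" "v = real_vec (\<omega> j)"
      using \<open>u \<in> \<Omega>\<close> \<open>v \<in> \<Omega>\<close> assms(1) by blast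
    then show ?thesis using real_vec_diff_denom_l1_le leE unfolding N_def by blast
  qed
  then have le: "1 \<le> ?n * N ^ CARD('n) * facet_gap \<Omega>"
    using facet_gap_attained [OF fin assms(2)] infdist_facet_lower_bound [OF fin N] by metis
  have c: "0 < ?n * N ^ CARD('n)" using N by simp
  have gap: "0 < facet_gap \<Omega>"
    using le c by (smt (verit) zero_less_mult_pos)
  have "log 2 (1 / facet_gap \<Omega>) \<le> log 2 (?n * N ^ CARD('n))"
    using le gap by (intro log_mono) (auto simp: field_simps)
  also have "\<dots> = log 2 ?n + ?n * (2 * (of_int E - 3 * ?n))"
    using N by (simp add: log_mult log_nat_power N_def)
  also have "\<dots> \<le> ?n + ?n * (2 * (of_int E - 3 * ?n))"
  proof -
    have "?n < 2 ^ CARD('n)" by (rule of_nat_less_two_power)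
    then have "log 2 ?n \<le> ?n" using n1 by (simp add: log_le_iff powr_realpow)
    then show ?thesis by simp
  qed
  \<comment> \<open>Very generous: 2nE is at most 6n^2 E, and the remaining n - 6n^2 is at most E -
    n.\<close>
  also have "\<dots> \<le> (6 * ?n ^ 2 + 1) * of_int E - ?n"
  proof -
    have sq: "?n \<le> ?n ^ 2" using n1 by (rule self_le_power) simp
    then have "2 * ?n * of_int E \<le> 6 * ?n ^ 2 * of_int E"
      using E3 n1 by (intro mult_right_mono) linarith+
    moreover have "?n + ?n * (2 * (of_int E - 3 * ?n)) = ?n + 2 * ?n * of_int E - 6 * ?n ^ 2"
      by (simp add: algebra_simps power2_eq_square)
    moreover have "(6 * ?n ^ 2 + 1) * of_int E = 6 * ?n ^ 2 * of_int E + of_int E"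
      by (simp add: algebra_simps)
    ultimately show ?thesis using E3 n1 sq by linarith
  qed
  finally show ?thesis unfolding E_def .
qed

end
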